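(* If $D\subset\mathbb{R}^d$ is a (nonempty) bounded $C^{1,1}$ open set, then $$0\le \iota_D(x)-\kappa_D(x)=o(\kappa_D(x))\quad\text{as }\delta_D(x)\to 0,\ x\in D.$$ That is, $\iota_D\geq\kappa_D$ on $D$ and for every $\varepsilon>0$ there is $\eta>0$ such that $\iota_D(x)-\kappa_D(x)\le\varepsilon\,\kappa_D(x)$ for all $x\in D$ with $\delta_D(x)<\eta$.
   Context: $d\ge1$, $0<\alpha<2$; $\nu(z)=\mathcal{A}_{d,\alpha}|z|^{-d-\alpha}$ for $z\in\mathbb{R}^d$, with $\mathcal{A}_{d,\alpha}=2^\alpha\Gamma((d+\alpha)/2)\pi^{-d/2}/|\Gamma(-\alpha/2)|$. For $x\in D$, $D_x=\{y\in D:[x,y]\subset D\}$, where $[x,y]$ is the line segment between $x$ and $y$. The killing intensity is $\kappa_D(x)=\int_{D^c}\nu(y-x)\,dy$ and the shooting-down intensity is $\iota_D(x)=\int_{\mathbb{R}^d\setminus D_x}\nu(y-x)\,dy$, $x\in D$. $\delta_D(x)=\mathrm{dist}(x,D^c)$. An open set $D$ is $C^{1,1}$ (at scale $r>0$) if for every $Q\in\partial D$ there are balls $B(x',r)\subset D$ and $B(x'',r)\subset D^c$ tangent at $Q$; a $C^{1,1}$ set is one that is $C^{1,1}$ at some scale $r>0$. *)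

theory Defs
  imports "HOL-Analysis.Analysis"
begin

text \<open>The space $\mathbb{R}^d$ is rendered by a type of class \<^class>\<open>euclidean_space\<close>, with
  $d$ being its dimension.\<close>

definition stable_const :: "'a::euclidean_space itself \<Rightarrow> real \<Rightarrow> real" where
  "stable_const _ \<alpha> =
     2 powr \<alpha> * Gamma ((real DIM('a) + \<alpha>) / 2) * pi powr (- real DIM('a) / 2)
       / \<bar>Gamma (- \<alpha> / 2)\<bar>"

definition levy_density :: "real \<Rightarrow> 'a::euclidean_space \<Rightarrow> real" where
  "levy_density \<alpha> z = stable_const TYPE('a) \<alpha> * norm z powr (- real DIM('a) - \<alpha>)"

definition visible_part :: "'a::euclidean_space set \<Rightarrow> 'a \<Rightarrow> 'a set" where
  "visible_part D x = {y \<in> D. closed_segment x y \<subseteq> D}"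

text \<open>Both intensities are used only for \<open>D\<close> open and \<open>x \<in> D\<close>.  Then the domains of integration are
  closed and omit a ball around \<open>x\<close>, so the integrals are finite, and the value of
  \<^const>\<open>levy_density\<close> at the origin plays no role.\<close>

definition killing_intensity :: "real \<Rightarrow> 'a::euclidean_space set \<Rightarrow> 'a \<Rightarrow> real" where
  "killing_intensity \<alpha> D x = (LINT y:(- D)|lborel. levy_density \<alpha> (y - x))"

definition shooting_down_intensity :: "real \<Rightarrow> 'a::euclidean_space set \<Rightarrow> 'a \<Rightarrow> real" where
  "shooting_down_intensity \<alpha> D x = (LINT y:(- visible_part D x)|lborel. levy_density \<alpha> (y - x))"

text \<open>Two balls of the same radius, one in \<open>D\<close> and one in its complement, are tangent at \<open>Q\<close> when
  \<open>Q\<close> is the only common point of their boundary spheres.\<close>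

definition C11_at_scale :: "'a::euclidean_space set \<Rightarrow> real \<Rightarrow> bool" where
  "C11_at_scale D r \<longleftrightarrow>
     (\<forall>Q\<in>frontier D. \<exists>x' x''. ball x' r \<subseteq> D \<and> ball x'' r \<subseteq> - D \<and> sphere x' r \<inter> sphere x'' r = {Q})"

definition C11_set :: "'a::euclidean_space set \<Rightarrow> bool" where
  "C11_set D \<longleftrightarrow> (\<exists>r>0. C11_at_scale D r)"

end

theory Submission
  imports Defs
begin

text \<open>Near the boundary write \<open>x = Q + \<delta> n\<close> with \<open>Q\<close> the nearest boundary point and \<open>n\<close> the inner unit
  normal; then \<open>\<kappa>\<^sub>D x \<ge> c \<delta>\<^sup>-\<^sup>\<alpha>\<close>, because the outer tangent ball contains a ball of radius \<open>\<delta>\<close>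
  within distance \<open>3\<delta>\<close> of \<open>x\<close>.  The difference of the intensities is the integral over the points of \<open>D\<close>
  not visible from \<open>x\<close>.  Those at distance at least \<open>M\<delta>\<close> contribute at most \<open>C (M\<delta>)\<^sup>-\<^sup>\<alpha>\<close>.  The others
  lie outside both tangent balls, the inner one being convex and containing \<open>x\<close>, hence in a slab of thickness
  \<open>O(M\<^sup>2\<delta>\<^sup>2)\<close>; their density is at most a multiple of \<open>\<delta>\<^sup>-\<^sup>d\<^sup>-\<^sup>\<alpha>\<close> and their volume is \<open>o(\<delta>\<^sup>d)\<close> for each
  fixed \<open>M\<close>.\<close>

section \<open>Tails of the kernel and the volume of thin slabs\<close>

definition powr_tail_const :: "'a::euclidean_space itself \<Rightarrow> real \<Rightarrow> real" where
  "powr_tail_const _ \<alpha> = unit_ball_vol (real DIM('a)) * 2 ^ DIM('a) / (1 - 2 powr - \<alpha>)"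

text \<open>The constant is that of the dyadic shells \<open>2\<^sup>k R \<le> \<bar>y - x\<bar> < 2\<^sup>k\<^sup>+\<^sup>1 R\<close>, summed as a geometric series.\<close>

lemma norm_powr_tail:
  fixes x :: "'a::euclidean_space"
  assumes \<alpha>: "0 < \<alpha>" and R: "0 < R"
  shows "set_integrable lborel (- ball x R) (\<lambda>y. norm (y - x) powr (- real DIM('a) - \<alpha>))"
    and "(LINT y:- ball x R|lborel. norm (y - x) powr (- real DIM('a) - \<alpha>))
      \<le> powr_tail_const TYPE('a) \<alpha> * R powr - \<alpha>"
proof -
  let ?d = "DIM('a)" and ?V = "unit_ball_vol (real DIM('a))"
  define C where "C = powr_tail_const TYPE('a) \<alpha>"
  define g where "g y = norm (y - x) powr (- real ?d - \<alpha>)" for y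
  define q where "q = (2::real) powr - \<alpha>"
  have q: "0 < q" "q < 1"
    using \<alpha> by (auto simp: q_def powr_less_one)
  have [measurable]: "g \<in> borel_measurable borel"
    unfolding g_def by measurable
  define c where "c k = (2 ^ k * R) powr (- real ?d - \<alpha>)" for k :: nat
  define B where "B k = ball x (2 ^ Suc k * R)" for k :: nat
  have [measurable]: "B k \<in> sets borel" for k
    by (simp add: B_def)
  \<comment> \<open>Each dyadic shell is enlarged to the full ball \<open>B k\<close>. This costs
    only a constant factor, and the single term belonging to the shell of \<open>y\<close> already
    dominates.\<close>
  have pointwise: "ennreal (indicator (- ball x R) y * g y) \<le> (\<Sum>k. ennreal (c k) * indicator (B k) y)" for y
  proof (cases "y \<in> ball x R")
    case False
    define t where "t = norm (y - x)"
    have t: "R \<le> t"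
      using False by (simp add: t_def dist_norm norm_minus_commute)
    have "0 < t"
      using t R by simp
    \<comment> \<open>The index of the shell containing \<open>y\<close>: minimality gives the lower
      bound \<open>2 ^ k * R \<le> t\<close>, except for \<open>k = 0\<close>, where it is
      \<open>R \<le> t\<close>.\<close>
    define k where "k = (LEAST k. t < 2 ^ Suc k * R)"
    have "\<exists>k. t / R < 2 ^ k"
      by (rule real_arch_pow) simp
    then obtain m where "t / R < 2 ^ m" ..
    then have "t < 2 ^ m * R"
      using R by (simp add: field_simps)
    also have "\<dots> \<le> 2 ^ Suc m * R"
      using R by simp
    finally have k1: "t < 2 ^ Suc k * R"
      unfolding k_def by (rule LeastI)
    have k2: "2 ^ k * R \<le> t"
    proof (cases k)
      case (Suc j)
      then have "\<not> t < 2 ^ Suc j * R"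
        using not_less_Least[of j "\<lambda>k. t < 2 ^ Suc k * R"] by (simp add: k_def)
      then show ?thesis
        using Suc by simp
    qed (use t in simp)
    have "g y \<le> c k"
      unfolding g_def c_def t_def[symmetric]
      by (rule powr_mono2') (use k2 R \<alpha> in auto)
    moreover have "y \<in> B k"
      using k1 by (simp add: B_def t_def dist_norm norm_minus_commute)
    ultimately have "ennreal (indicator (- ball x R) y * g y) \<le> ennreal (c k) * indicator (B k) y"
      using False by (simp add: ennreal_leI)
    also have "\<dots> \<le> (\<Sum>k. ennreal (c k) * indicator (B k) y)"
      using sum_le_suminf[OF summableI, of "{k}" "\<lambda>k. ennreal (c k) * indicator (B k) y"]
      by (simp del: sum_mult_indicator)
    finally show ?thesis .
  qed simp
  \<comment> \<open>With \<open>s = 2 ^ k * R\<close>, the kernel scales like \<open>s\<close> to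
    the power -d-\<alpha> and the volume like \<open>s\<close> to the power d. What is left is
    \<open>s powr - \<alpha>\<close>, geometric in \<open>k\<close> with ratio \<open>q < 1\<close>
    because \<alpha> is positive.\<close>
  have shell: "c k * (?V * (2 ^ Suc k * R) ^ ?d) = ?V * 2 ^ ?d * R powr - \<alpha> * q ^ k" for k
  proof -
    let ?s = "2 ^ k * R"
    have s: "0 < ?s"
      using R by simp
    have "(2 ^ Suc k * R) ^ ?d = 2 ^ ?d * ?s ^ ?d"
      by (simp add: power_mult_distrib)
    moreover have "c k * ?s ^ ?d = ?s powr - \<alpha>"
      using s by (simp add: c_def powr_realpow[symmetric] powr_add[symmetric])
    moreover have "?s powr - \<alpha> = R powr - \<alpha> * q ^ k"
      using R by (simp add: powr_mult q_def powr_realpow[symmetric] powr_powr mult.commute)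
    ultimately show ?thesis
      by simp
  qed
  have "(\<integral>\<^sup>+y. ennreal (indicator (- ball x R) y * g y) \<partial>lborel)
      \<le> (\<integral>\<^sup>+y. (\<Sum>k. ennreal (c k) * indicator (B k) y) \<partial>lborel)"
    by (intro nn_integral_mono pointwise)
  also have "\<dots> = (\<Sum>k. \<integral>\<^sup>+y. ennreal (c k) * indicator (B k) y \<partial>lborel)"
    by (rule nn_integral_suminf) measurable
  also have "\<dots> = (\<Sum>k. ennreal (?V * 2 ^ ?d * R powr - \<alpha> * q ^ k))"
  proof (intro suminf_cong)
    fix k
    have "(\<integral>\<^sup>+y. ennreal (c k) * indicator (B k) y \<partial>lborel) = ennreal (c k) * emeasure lborel (B k)"
      by (rule nn_integral_cmult_indicator) simp
    also have "\<dots> = ennreal (c k * (?V * (2 ^ Suc k * R) ^ ?d))"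
      using R by (simp add: B_def emeasure_ball ennreal_mult'[symmetric] c_def)
    finally show "(\<integral>\<^sup>+y. ennreal (c k) * indicator (B k) y \<partial>lborel)
        = ennreal (?V * 2 ^ ?d * R powr - \<alpha> * q ^ k)"
      by (simp only: shell)
  qed
  also have "\<dots> = ennreal (\<Sum>k. ?V * 2 ^ ?d * R powr - \<alpha> * q ^ k)"
    using q by (intro suminf_ennreal2) (auto intro!: summable_mult)
  also have "(\<Sum>k. ?V * 2 ^ ?d * R powr - \<alpha> * q ^ k) = C * R powr - \<alpha>"
    using q by (simp add: suminf_mult suminf_geometric C_def powr_tail_const_def q_def[symmetric])
  finally have le: "(\<integral>\<^sup>+y. ennreal (indicator (- ball x R) y * g y) \<partial>lborel) \<le> ennreal (C * R powr - \<alpha>)" .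
  \<comment> \<open>Sum and integral were exchanged in \<open>ennreal\<close>, where no
    integrability is required; the finite bound now yields it.\<close>
  have int: "integrable lborel (\<lambda>y. indicator (- ball x R) y * g y)"
    using le by (intro integrableI_nonneg) (auto simp: g_def intro: le_less_trans)
  then show "set_integrable lborel (- ball x R) (\<lambda>y. norm (y - x) powr (- real DIM('a) - \<alpha>))"
    by (simp add: set_integrable_def g_def)
  have "0 \<le> C"
    using q by (simp add: C_def powr_tail_const_def q_def[symmetric])
  then have "(\<integral>y. indicator (- ball x R) y * g y \<partial>lborel) \<le> C * R powr - \<alpha>"
    using nn_integral_eq_integral[OF int] le by (simp add: g_def)
  then show "(LINT y:- ball x R|lborel. norm (y - x) powr (- real DIM('a) - \<alpha>))
      \<le> powr_tail_const TYPE('a) \<alpha> * R powr - \<alpha>"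
    by (simp add: set_lebesgue_integral_def g_def C_def)
qed

text \<open>\<open>N\<close> translates of the set along the normal of the slab are disjoint and fit into a ball of twice
  the radius.\<close>

lemma measure_thin_slab_le:
  fixes S :: "'a::euclidean_space set"
  assumes S: "S \<in> sets borel" "S \<subseteq> ball x \<rho>" and n: "norm n = 1"
    and slab: "\<And>y. y \<in> S \<Longrightarrow> \<bar>n \<bullet> (y - Q)\<bar> \<le> h"
    and h: "0 < h" "real N * (3 * h) \<le> \<rho>"
  shows "real N * measure lborel S \<le> measure lborel (ball x (2 * \<rho>))"
proof -
  \<comment> \<open>The spacing \<open>3 * h\<close> exceeds the slab width \<open>2 * h\<close>,
    which separates the translates, while every shift has length at most
    \<open>real N * (3 * h)\<close>, hence at most \<open>\<rho>\<close>.\<close>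
  define T where "T k = (+) ((3 * h * real k) *\<^sub>R n) ` S" for k :: nat
  have "S \<in> lmeasurable"
    by (rule bounded_set_imp_lmeasurable)
      (use S in \<open>auto intro: bounded_subset[OF bounded_ball]\<close>)
  then have T: "T k \<in> lmeasurable" for k
    unfolding T_def by (rule measurable_translation)
  have "T k \<inter> T j = {}" if "k \<noteq> j" for k j
  proof (rule ccontr)
    assume "T k \<inter> T j \<noteq> {}"
    then obtain y z where yz: "y \<in> S" "z \<in> S"
      and eq: "(3 * h * real k) *\<^sub>R n + y = (3 * h * real j) *\<^sub>R n + z"
      by (auto simp: T_def)
    have nn: "n \<bullet> n = 1"
      using n by (simp add: norm_eq_1)
    have "n \<bullet> ((3 * h * real k) *\<^sub>R n + y) = n \<bullet> ((3 * h * real j) *\<^sub>R n + z)"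
      by (simp only: eq)
    then have "3 * h * (real k - real j) = n \<bullet> (z - Q) - n \<bullet> (y - Q)"
      by (simp add: inner_simps nn algebra_simps)
    then have "\<bar>3 * h * (real k - real j)\<bar> \<le> 2 * h"
      using slab[OF yz(1)] slab[OF yz(2)] by linarith
    then have "3 * h * \<bar>real k - real j\<bar> \<le> 2 * h"
      using h by (simp add: abs_mult)
    moreover have "1 \<le> \<bar>real k - real j\<bar>"
      using that by linarith
    then have "3 * h * 1 \<le> 3 * h * \<bar>real k - real j\<bar>"
      using h by (intro mult_left_mono) auto
    ultimately show False
      using h by linarith
  qed
  then have "measure lebesgue (\<Union>k<N. T k) = (\<Sum>k<N. measure lebesgue (T k))"
    by (intro measure_UNION') (auto simp: pairwise_def disjnt_def T)
  then have "real N * measure lebesgue S = measure lebesgue (\<Union>k<N. T k)"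
    by (simp add: T_def measure_translation)
  also have "\<dots> \<le> measure lebesgue (ball x (2 * \<rho>))"
  proof (rule measure_mono_fmeasurable)
    show "(\<Union>k<N. T k) \<subseteq> ball x (2 * \<rho>)"
    proof (clarsimp simp: T_def)
      fix k y assume k: "k < N" and y: "y \<in> S"
      have "dist x ((3 * h * real k) *\<^sub>R n + y) \<le> dist x y + norm ((3 * h * real k) *\<^sub>R n)"
        by (metis add.commute dist_norm dist_triangle norm_minus_commute add_diff_cancel_left' add_diff_cancel_right')
      also have "norm ((3 * h * real k) *\<^sub>R n) \<le> real N * (3 * h)"
        using k h n by simp
      finally show "dist x ((3 * h * real k) *\<^sub>R n + y) < 2 * \<rho>"
        using y S h by fastforce
    qed
    show "(\<Union>k<N. T k) \<in> sets lebesgue"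
      using T by (intro sets.finite_UN) (auto simp: fmeasurable_def)
  qed simp
  finally show ?thesis
    using S by (simp add: measure_completion)
qed

section \<open>Tangent balls and the visible part\<close>

text \<open>If the centres were closer, the point dividing the segment between them in the ratio
  \<open>r : s\<close> would lie in both balls.\<close>

lemma disjoint_balls_dist_ge:
  fixes a b :: "'a::real_normed_vector"
  assumes "ball a r \<inter> ball b s = {}" "0 < r" "0 < s"
  shows "r + s \<le> dist a b"
proof (rule ccontr)
  assume less: "\<not> r + s \<le> dist a b"
  define u where "u = r / (r + s)"
  have u: "0 < u" "0 < 1 - u" "u * (r + s) = r" "(1 - u) * (r + s) = s"
    using assms by (auto simp: u_def field_simps)
  let ?z = "a + u *\<^sub>R (b - a)"
  have "a - ?z = - (u *\<^sub>R (b - a))" "b - ?z = (1 - u) *\<^sub>R (b - a)"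
    by (auto simp: algebra_simps)
  then have "dist a ?z = u * dist a b" "dist b ?z = (1 - u) * dist a b"
    using u by (simp_all add: dist_norm norm_minus_commute)
  moreover have "u * dist a b < u * (r + s)" "(1 - u) * dist a b < (1 - u) * (r + s)"
    by (rule mult_strict_left_mono; use u less in simp)+
  ultimately have "dist a ?z < r" "dist b ?z < s"
    using u(3,4) by linarith+
  then have "?z \<in> ball a r \<inter> ball b s"
    by simp
  then show False
    using assms by blast
qed

text \<open>Passing from \<open>a\<close> to \<open>b\<close> through \<open>Q\<close> has length
  \<open>r + s\<close>, and disjointness forbids anything shorter. So the triangle inequality is an
  equality, and in an inner product space this forces \<open>a - Q\<close> and \<open>Q - b\<close>
  to have the same direction.\<close>

lemma disjoint_balls_tangent:
  fixes a b Q :: "'a::real_inner"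
  assumes "ball a r \<inter> ball b s = {}" "0 < r" "0 < s" "dist a Q = r" "dist b Q = s"
  shows "r *\<^sub>R (Q - b) = s *\<^sub>R (a - Q)"
proof -
  have "r + s \<le> norm ((a - Q) + (Q - b))"
    using disjoint_balls_dist_ge[OF assms(1-3)] by (simp add: dist_norm)
  moreover have "norm (a - Q) = r" "norm (Q - b) = s"
    using assms by (auto simp: dist_norm norm_minus_commute)
  ultimately have "norm ((a - Q) + (Q - b)) = norm (a - Q) + norm (Q - b)"
    using norm_triangle_ineq[of "a - Q" "Q - b"] by simp
  then show ?thesis
    unfolding norm_triangle_eq using \<open>norm (a - Q) = r\<close> \<open>norm (Q - b) = s\<close> by simp
qed

text \<open>A compact segment inside \<open>D\<close> has a whole \<open>e\<close>-neighbourhood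
  inside \<open>D\<close>, and moving the endpoint \<open>y\<close> by less than \<open>e\<close>
  moves each point of the segment by less than \<open>e\<close>. This makes the set of invisible
  points Borel.\<close>

lemma open_visible_part:
  assumes "open D"
  shows "open (visible_part D x)"
  unfolding open_contains_ball
proof
  fix y assume y: "y \<in> visible_part D x"
  then have "closed_segment x y \<subseteq> D"
    by (simp add: visible_part_def)
  then obtain e where e: "0 < e" "(\<Union>z\<in>closed_segment x y. ball z e) \<subseteq> D"
    using compact_subset_open_imp_ball_epsilon_subset[OF compact_segment assms] by metis
  have "closed_segment x z \<subseteq> D" if z: "z \<in> ball y e" for z
  proof
    fix w assume "w \<in> closed_segment x z"
    then obtain u where u: "0 \<le> u" "u \<le> 1" "w = (1 - u) *\<^sub>R x + u *\<^sub>R z"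
      by (auto simp: in_segment)
    let ?v = "(1 - u) *\<^sub>R x + u *\<^sub>R y"
    have "?v - w = u *\<^sub>R (y - z)"
      by (simp add: u algebra_simps)
    then have "dist ?v w = u * dist y z"
      using u by (simp add: dist_norm)
    also have "\<dots> \<le> dist y z"
      using u by (simp add: mult_left_le_one_le)
    finally have "w \<in> ball ?v e"
      using z by simp
    moreover have "?v \<in> closed_segment x y"
      using u by (auto simp: in_segment)
    ultimately show "w \<in> D"
      using e by blast
  qed
  then have "ball y e \<subseteq> visible_part D x"
    using ends_in_segment(2) unfolding visible_part_def by blast
  with e show "\<exists>e>0. ball y e \<subseteq> visible_part D x"
    by blast
qed

lemma convex_subset_visible_part:
  assumes "convex B" "B \<subseteq> D" "x \<in> B"
  shows "B \<subseteq> visible_part D x"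
  using assms closed_segment_subset[OF \<open>x \<in> B\<close> _ \<open>convex B\<close>] by (force simp: visible_part_def)

text \<open>At a nearest point \<open>Q\<close> of the complement three balls touch: the one around
  \<open>x\<close>, the inner and the outer tangent ball. The outer one is disjoint from the other
  two, so tangency puts all centres on one line through \<open>Q\<close>.\<close>

lemma C11_tangent_balls:
  fixes D :: "'a::euclidean_space set"
  assumes D: "open D" "D \<noteq> UNIV" "x \<in> D" and C: "C11_at_scale D r" "0 < r"
  obtains Q n where "norm n = 1" "x = Q + infdist x (- D) *\<^sub>R n" "0 < infdist x (- D)"
    "ball x (infdist x (- D)) \<subseteq> D" "ball (Q + r *\<^sub>R n) r \<subseteq> D" "ball (Q - r *\<^sub>R n) r \<subseteq> - D"
proof -
  define \<delta> where "\<delta> = infdist x (- D)"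
  have cl: "closed (- D)" and ne: "- D \<noteq> {}"
    using D by auto
  obtain Q where Q: "Q \<in> - D" "\<delta> = dist x Q"
    using infdist_attains_inf[OF cl ne] unfolding \<delta>_def by metis
  have \<delta>: "0 < \<delta>"
    using Q D by auto
  have in_D: "ball x \<delta> \<subseteq> D"
    unfolding \<delta>_def using infdist_le[of _ "- D" x] by (force simp: not_less[symmetric])
  have "Q \<in> closure (ball x \<delta>)"
    using \<delta> Q by simp
  then have "Q \<in> frontier D"
    using closure_mono[OF in_D] Q D by (auto simp: frontier_def interior_open)
  then obtain a b where ab: "ball a r \<subseteq> D" "ball b r \<subseteq> - D" "sphere a r \<inter> sphere b r = {Q}"
    using C unfolding C11_at_scale_def by blast
  then have dist: "dist a Q = r" "dist b Q = r"
    by auto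
  \<comment> \<open>The normal is read off from the outer ball, since both applications of tangency
    compare with its centre \<open>b\<close>.\<close>
  define n where "n = (1 / r) *\<^sub>R (Q - b)"
  have rn: "r *\<^sub>R n = Q - b"
    using C by (simp add: n_def)
  have "r *\<^sub>R (Q - b) = r *\<^sub>R (a - Q)"
    using ab dist C by (intro disjoint_balls_tangent) auto
  then have "a - Q = Q - b"
    using C by simp
  then have a: "a = Q + r *\<^sub>R n"
    by (simp add: rn algebra_simps)
  have b: "b = Q - r *\<^sub>R n"
    by (simp add: rn)
  have "\<delta> *\<^sub>R (Q - b) = r *\<^sub>R (x - Q)"
    using ab in_D Q dist C \<delta> by (intro disjoint_balls_tangent) auto
  then have "r *\<^sub>R (x - Q) = r *\<^sub>R (\<delta> *\<^sub>R n)"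
    using rn by (metis scaleR_left_commute)
  then have "x - Q = \<delta> *\<^sub>R n"
    using C by (simp only: scaleR_cancel_left) simp
  then have x: "x = Q + \<delta> *\<^sub>R n"
    by (simp add: algebra_simps)
  have "norm n = 1"
    using dist C by (simp add: n_def dist_norm norm_minus_commute)
  then show ?thesis
    using that x \<delta> in_D ab a b unfolding \<delta>_def by blast
qed

text \<open>Both centres are at distance \<open>r\<close> from \<open>Q\<close>, so expanding the
  squared distances from \<open>y\<close> to them cancels \<open>r\<^sup>2\<close> and leaves bounds
  on the normal component of \<open>y - Q\<close> from both sides.\<close>

lemma between_tangent_balls_flat:
  fixes y Q n :: "'a::real_inner"
  assumes "norm n = 1" "0 < r" "y \<notin> ball (Q + r *\<^sub>R n) r" "y \<notin> ball (Q - r *\<^sub>R n) r"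
  shows "\<bar>n \<bullet> (y - Q)\<bar> \<le> (norm (y - Q))\<^sup>2 / (2 * r)"
proof -
  have nn: "n \<bullet> n = 1"
    using assms by (simp add: norm_eq_1)
  define v where "v = y - Q"
  have "r\<^sup>2 \<le> (norm (v - r *\<^sub>R n))\<^sup>2" "r\<^sup>2 \<le> (norm (v + r *\<^sub>R n))\<^sup>2"
    using assms by (auto intro!: power_mono simp: v_def dist_norm norm_minus_commute algebra_simps)
  moreover have "(norm (v - r *\<^sub>R n))\<^sup>2 = (norm v)\<^sup>2 - 2 * r * (n \<bullet> v) + r\<^sup>2"
    "(norm (v + r *\<^sub>R n))\<^sup>2 = (norm v)\<^sup>2 + 2 * r * (n \<bullet> v) + r\<^sup>2"
    unfolding power2_norm_eq_inner
    by (simp_all add: inner_add_left inner_add_right inner_diff_left inner_diff_right nn inner_commute[of v n] power2_eq_square algebra_simps)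
  ultimately have "2 * r * \<bar>n \<bullet> v\<bar> \<le> (norm v)\<^sup>2"
    by (simp add: abs_if)
  then show ?thesis
    using assms by (simp add: v_def field_simps)
qed

section \<open>Estimates of the two integrals\<close>

lemma set_integral_mono_set:
  fixes f :: "'a \<Rightarrow> real"
  assumes "set_integrable M B f" "A \<in> sets M" "A \<subseteq> B" "\<And>y. 0 \<le> f y"
  shows "(LINT y:A|M. f y) \<le> (LINT y:B|M. f y)"
  using set_integrable_subset[OF assms(1-3)] assms unfolding set_integrable_def set_lebesgue_integral_def
  by (intro integral_mono) (auto split: split_indicator)

lemma set_integral_ge_const:
  fixes f :: "'a \<Rightarrow> real"
  assumes "set_integrable M A f" "A \<in> fmeasurable M" "\<And>y. y \<in> A \<Longrightarrow> c \<le> f y"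
  shows "c * measure M A \<le> (LINT y:A|M. f y)"
proof -
  have "(LINT y:A|M. c) = c * measure M A" "set_integrable M A (\<lambda>_. c)"
    using assms(2) by (auto simp: set_lebesgue_integral_def set_integrable_def fmeasurable_def)
  then show ?thesis
    using set_integral_mono[of M A "\<lambda>_. c" f] assms by simp
qed

lemma set_integral_le_const:
  fixes f :: "'a \<Rightarrow> real"
  assumes "set_integrable M A f" "A \<in> fmeasurable M" "\<And>y. y \<in> A \<Longrightarrow> f y \<le> c"
  shows "(LINT y:A|M. f y) \<le> c * measure M A"
proof -
  have "(LINT y:A|M. c) = c * measure M A" "set_integrable M A (\<lambda>_. c)"
    using assms(2) by (auto simp: set_lebesgue_integral_def set_integrable_def fmeasurable_def)
  then show ?thesis
    using set_integral_mono[of M A f "\<lambda>_. c"] assms by simp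
qed

lemma set_integrable_norm_powr:
  fixes x :: "'a::euclidean_space"
  assumes "0 < \<alpha>" "0 < R" "E \<in> sets borel" "E \<subseteq> - ball x R"
  shows "set_integrable lborel E (\<lambda>y. norm (y - x) powr (- real DIM('a) - \<alpha>))"
  using set_integrable_subset[OF norm_powr_tail(1)[OF assms(1,2)]] assms by simp

lemma killing_integral_ge:
  fixes D :: "'a::euclidean_space set"
  assumes \<alpha>: "0 < \<alpha>" and D: "open D" and n: "norm n = 1" and x: "x = Q + \<delta> *\<^sub>R n"
    and \<delta>: "0 < \<delta>" "\<delta> \<le> r" and ball_x: "ball x \<delta> \<subseteq> D" and outer: "ball (Q - r *\<^sub>R n) r \<subseteq> - D"
  shows "unit_ball_vol (real DIM('a)) * 3 powr (- real DIM('a) - \<alpha>) * \<delta> powr - \<alpha>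
    \<le> (LINT y:- D|lborel. norm (y - x) powr (- real DIM('a) - \<alpha>))"
proof -
  let ?d = "DIM('a)"
  \<comment> \<open>The outer ball shrunk towards \<open>Q\<close> to radius \<delta>; it stays
    inside because \<open>\<delta> \<le> r\<close>. Its centre is at distance
    \<open>2 * \<delta>\<close> from \<open>x\<close>, whence the factor 3 below.\<close>
  let ?B = "ball (Q - \<delta> *\<^sub>R n) \<delta>"
  have "dist (Q - \<delta> *\<^sub>R n) (Q - r *\<^sub>R n) = norm ((r - \<delta>) *\<^sub>R n)"
    by (simp add: dist_norm algebra_simps)
  then have "?B \<subseteq> ball (Q - r *\<^sub>R n) r"
    unfolding ball_subset_ball_iff using \<delta> n by simp
  with outer have B: "?B \<subseteq> - D"
    by blast
  have int: "set_integrable lborel (- D) (\<lambda>y. norm (y - x) powr (- real ?d - \<alpha>))"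
    by (rule set_integrable_norm_powr[OF \<alpha> \<delta>(1)]) (use D ball_x in auto)
  have "(3 * \<delta>) powr (- real ?d - \<alpha>) * measure lborel ?B
      \<le> (LINT y:?B|lborel. norm (y - x) powr (- real ?d - \<alpha>))"
  proof (rule set_integral_ge_const)
    show "set_integrable lborel ?B (\<lambda>y. norm (y - x) powr (- real ?d - \<alpha>))"
      by (rule set_integrable_subset[OF int _ B]) simp
    show "?B \<in> fmeasurable lborel"
      using emeasure_bounded_finite[OF bounded_ball] by (simp add: fmeasurable_def)
    fix y assume y: "y \<in> ?B"
    have "(2 * \<delta>) *\<^sub>R n = \<delta> *\<^sub>R n + \<delta> *\<^sub>R n"
      by (simp flip: scaleR_left_distrib)
    then have "y - x = (y - (Q - \<delta> *\<^sub>R n)) - (2 * \<delta>) *\<^sub>R n"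
      by (simp add: x)
    then have "norm (y - x) \<le> norm (y - (Q - \<delta> *\<^sub>R n)) + norm ((2 * \<delta>) *\<^sub>R n)"
      by (simp only: norm_triangle_ineq4)
    then have "norm (y - x) \<le> 3 * \<delta>"
      using y \<delta> n by (simp add: dist_norm norm_minus_commute)
    \<comment> \<open>Since \<open>0 powr p\<close> is \<open>0\<close> even for negative
      \<open>p\<close>, comparing the powers requires \<open>y\<close> to differ from
      \<open>x\<close>.\<close>
    moreover have "x \<in> D" "y \<notin> D"
      using ball_x \<delta> y B by auto
    then have "0 < norm (y - x)"
      by auto
    ultimately show "(3 * \<delta>) powr (- real ?d - \<alpha>) \<le> norm (y - x) powr (- real ?d - \<alpha>)"
      using \<alpha> by (intro powr_mono2') auto
  qed
  also have "\<dots> \<le> (LINT y:- D|lborel. norm (y - x) powr (- real ?d - \<alpha>))"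
    by (rule set_integral_mono_set[OF int _ B]) auto
  also have "(3 * \<delta>) powr (- real ?d - \<alpha>) * measure lborel ?B
      = unit_ball_vol (real ?d) * 3 powr (- real ?d - \<alpha>) * (\<delta> powr (- real ?d - \<alpha>) * \<delta> ^ ?d)"
    using \<delta> by (simp add: content_ball powr_mult)
  also have "\<delta> powr (- real ?d - \<alpha>) * \<delta> ^ ?d = \<delta> powr - \<alpha>"
    using \<delta> by (simp add: powr_realpow[symmetric] powr_add[symmetric])
  finally show ?thesis .
qed

text \<open>\<open>M\<close> and \<open>N\<close> stay free: the far part costs a multiple of
  \<open>M powr - \<alpha>\<close>, the near part a multiple of \<open>1 / real N\<close> depending
  on \<open>M\<close>. The condition linking them to \<delta> says that \<open>N\<close> spaced
  translates of the slab fit.\<close>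

lemma nonvisible_integral_le:
  fixes D :: "'a::euclidean_space set"
  assumes \<alpha>: "0 < \<alpha>" and D: "open D" and n: "norm n = 1" and x: "x = Q + \<delta> *\<^sub>R n"
    and \<delta>: "0 < \<delta>" "\<delta> \<le> r" and ball_x: "ball x \<delta> \<subseteq> D"
    and inner: "ball (Q + r *\<^sub>R n) r \<subseteq> D" and outer: "ball (Q - r *\<^sub>R n) r \<subseteq> - D"
    and M: "0 < M" and N: "0 < N" "3 * real N * (M + 1)\<^sup>2 * \<delta> \<le> 2 * r * M"
  shows "(LINT y:D - visible_part D x|lborel. norm (y - x) powr (- real DIM('a) - \<alpha>))
    \<le> (powr_tail_const TYPE('a) \<alpha> * M powr - \<alpha>
        + unit_ball_vol (real DIM('a)) * (2 * M) ^ DIM('a) / real N) * \<delta> powr - \<alpha>"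
proof -
  let ?d = "DIM('a)"
  define g where "g y = norm (y - x) powr (- real ?d - \<alpha>)" for y
  define E where "E = D - visible_part D x"
  define S where "S = E \<inter> ball x (M * \<delta>)"
  have [measurable]: "E \<in> sets borel"
    using D open_visible_part[OF D] by (simp add: E_def)
  have [measurable]: "S \<in> sets borel"
    by (simp add: S_def)
  have r: "0 < r"
    using \<delta> by simp
  have "ball x \<delta> \<subseteq> visible_part D x"
    using ball_x \<delta> by (intro convex_subset_visible_part) auto
  then have E_ball: "E \<subseteq> - ball x \<delta>"
    by (auto simp: E_def)
  \<comment> \<open>For \<open>0 < \<delta> \<le> r\<close> the point \<open>x\<close> lies in the
    inner tangent ball, which is convex and therefore entirely visible from
    \<open>x\<close>.\<close>
  have "norm ((r - \<delta>) *\<^sub>R n) < r"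
    using n \<delta> by simp
  then have "x \<in> ball (Q + r *\<^sub>R n) r"
    by (simp add: x dist_norm algebra_simps)
  then have "ball (Q + r *\<^sub>R n) r \<subseteq> visible_part D x"
    using inner by (intro convex_subset_visible_part) auto
  then have E_out: "y \<notin> ball (Q + r *\<^sub>R n) r" "y \<notin> ball (Q - r *\<^sub>R n) r" if "y \<in> E" for y
    using that outer by (auto simp: E_def)
  have int: "set_integrable lborel A g" if "A \<in> sets borel" "A \<subseteq> E" for A
    unfolding g_def using that E_ball by (intro set_integrable_norm_powr[OF \<alpha> \<delta>(1)]) auto
  \<comment> \<open>Points of \<open>S\<close> are within \<open>M * \<delta>\<close> of
    \<open>x\<close>, hence within \<open>(M + 1) * \<delta>\<close> of \<open>Q\<close>, and
    flatness gives this \<open>h\<close>. It is quadratic in \<delta>, against the linear radius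
    \<open>M * \<delta>\<close>.\<close>
  define h where "h = ((M + 1) * \<delta>)\<^sup>2 / (2 * r)"
  have slab: "\<bar>n \<bullet> (y - Q)\<bar> \<le> h" if "y \<in> S" for y
  proof -
    have "y - Q = (y - x) + \<delta> *\<^sub>R n"
      by (simp add: x)
    then have "norm (y - Q) \<le> norm (y - x) + norm (\<delta> *\<^sub>R n)"
      by (simp only: norm_triangle_ineq)
    also have "\<dots> \<le> (M + 1) * \<delta>"
      using that n \<delta> by (simp add: S_def dist_norm norm_minus_commute algebra_simps)
    finally have "(norm (y - Q))\<^sup>2 / (2 * r) \<le> h"
      unfolding h_def using r by (intro divide_right_mono power_mono) auto
    moreover have "\<bar>n \<bullet> (y - Q)\<bar> \<le> (norm (y - Q))\<^sup>2 / (2 * r)"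
      using that by (intro between_tangent_balls_flat[OF n r] E_out) (auto simp: S_def)
    ultimately show ?thesis
      by simp
  qed
  have "real N * measure lborel S \<le> measure lborel (ball x (2 * (M * \<delta>)))"
  proof (rule measure_thin_slab_le[OF _ _ n slab])
    show "0 < h"
      using M \<delta> r by (simp add: h_def)
    have "real N * (3 * h) = 3 * real N * (M + 1)\<^sup>2 * \<delta> * \<delta> / (2 * r)"
      by (simp add: h_def power2_eq_square)
    also have "\<dots> \<le> 2 * r * M * \<delta> / (2 * r)"
      using N \<delta> r by (intro divide_right_mono mult_right_mono) auto
    also have "\<dots> = M * \<delta>"
      using r by simp
    finally show "real N * (3 * h) \<le> M * \<delta>" .
  qed (auto simp: S_def)
  then have S_vol: "measure lborel S \<le> unit_ball_vol (real ?d) * (2 * M) ^ ?d / real N * \<delta> ^ ?d"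
    using N M \<delta> by (simp add: content_ball field_simps power_mult_distrib)
  have S_fin: "S \<in> fmeasurable lborel"
    by (rule fmeasurableI2[of "ball x (M * \<delta>)"]) 
      (use emeasure_bounded_finite[OF bounded_ball, of x "M * \<delta>"] in \<open>auto simp: fmeasurable_def S_def\<close>)
  have "(LINT y:S|lborel. g y) \<le> \<delta> powr (- real ?d - \<alpha>) * measure lborel S"
  proof (rule set_integral_le_const[OF int S_fin])
    fix y assume "y \<in> S"
    then have "\<delta> \<le> norm (y - x)"
      using E_ball by (force simp: S_def dist_norm norm_minus_commute)
    then show "g y \<le> \<delta> powr (- real ?d - \<alpha>)"
      unfolding g_def using \<alpha> \<delta> by (intro powr_mono2') auto
  qed (auto simp: S_def)
  also have "\<dots> \<le> \<delta> powr (- real ?d - \<alpha>) * (unit_ball_vol (real ?d) * (2 * M) ^ ?d / real N * \<delta> ^ ?d)"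
    by (intro mult_left_mono S_vol) simp
  also have "\<dots> = unit_ball_vol (real ?d) * (2 * M) ^ ?d / real N * (\<delta> powr (- real ?d - \<alpha>) * \<delta> ^ ?d)"
    by (simp add: mult_ac)
  also have "\<delta> powr (- real ?d - \<alpha>) * \<delta> ^ ?d = \<delta> powr - \<alpha>"
    using \<delta> by (simp add: powr_realpow[symmetric] powr_add[symmetric])
  finally have near: "(LINT y:S|lborel. g y) \<le> unit_ball_vol (real ?d) * (2 * M) ^ ?d / real N * \<delta> powr - \<alpha>" .
  have M\<delta>: "0 < M * \<delta>"
    using M \<delta> by simp
  have "(LINT y:E - ball x (M * \<delta>)|lborel. g y) \<le> (LINT y:- ball x (M * \<delta>)|lborel. g y)"
    unfolding g_def by (rule set_integral_mono_set[OF norm_powr_tail(1)[OF \<alpha> M\<delta>]]) auto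
  also have "\<dots> \<le> powr_tail_const TYPE('a) \<alpha> * (M * \<delta>) powr - \<alpha>"
    unfolding g_def by (rule norm_powr_tail(2)[OF \<alpha> M\<delta>])
  also have "(M * \<delta>) powr - \<alpha> = M powr - \<alpha> * \<delta> powr - \<alpha>"
    using M \<delta> by (simp add: powr_mult)
  finally have far: "(LINT y:E - ball x (M * \<delta>)|lborel. g y)
      \<le> powr_tail_const TYPE('a) \<alpha> * (M powr - \<alpha> * \<delta> powr - \<alpha>)" .
  have "E = (E - ball x (M * \<delta>)) \<union> S"
    by (auto simp: S_def)
  then have "(LINT y:E|lborel. g y) = (LINT y:(E - ball x (M * \<delta>)) \<union> S|lborel. g y)"
    by simp
  also have "\<dots> = (LINT y:E - ball x (M * \<delta>)|lborel. g y) + (LINT y:S|lborel. g y)"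
    by (intro set_integral_Un int) (auto simp: S_def)
  finally show ?thesis
    using near far unfolding E_def[symmetric] g_def[symmetric] by (simp add: algebra_simps)
qed

section \<open>Comparison of the intensities\<close>

text \<open>The complement of the visible part is the disjoint union of \<open>- D\<close> and the
  invisible part of \<open>D\<close>. Both avoid a ball around \<open>x\<close>, so the density is
  integrable on each and the integrals add.\<close>

lemma shooting_down_minus_killing:
  fixes D :: "'a::euclidean_space set"
  assumes "0 < \<alpha>" "open D" "x \<in> D"
  shows "shooting_down_intensity \<alpha> D x - killing_intensity \<alpha> D x
    = (LINT y:D - visible_part D x|lborel. levy_density \<alpha> (y - x))"
proof -
  obtain e where e: "0 < e" "ball x e \<subseteq> D"
    using assms by (auto simp: open_contains_ball)
  then have visible: "ball x e \<subseteq> visible_part D x"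
    by (intro convex_subset_visible_part) auto
  have sets: "- D \<in> sets borel" "D - visible_part D x \<in> sets borel"
    using assms open_visible_part[OF \<open>open D\<close>] by auto
  have int: "set_integrable lborel A (\<lambda>y. levy_density \<alpha> (y - x))"
    if "A \<in> sets borel" "A \<subseteq> - ball x e" for A
    unfolding levy_density_def
    by (intro set_integrable_mult_right set_integrable_norm_powr[OF \<open>0 < \<alpha>\<close> \<open>0 < e\<close>] that)
  have "- visible_part D x = - D \<union> (D - visible_part D x)"
    by (auto simp: visible_part_def)
  then have "shooting_down_intensity \<alpha> D x
      = (LINT y:- D \<union> (D - visible_part D x)|lborel. levy_density \<alpha> (y - x))"
    by (simp add: shooting_down_intensity_def)
  also have "\<dots> = killing_intensity \<alpha> D x
      + (LINT y:D - visible_part D x|lborel. levy_density \<alpha> (y - x))"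
    unfolding killing_intensity_def
    by (intro set_integral_Un int sets) (use e(2) visible in auto)
  finally show ?thesis
    by simp
qed

text \<open>The constant is a common factor of both intensities, so only its sign enters the
  comparison.\<close>

lemma stable_const_nonneg:
  assumes "0 < \<alpha>"
  shows "0 \<le> stable_const TYPE('a::euclidean_space) \<alpha>"
  using assms Gamma_real_pos[of "(real DIM('a) + \<alpha>) / 2"] by (simp add: stable_const_def)

theorem theorem3p3:
  fixes D :: "'a::euclidean_space set" and \<alpha> :: real
  assumes "0 < \<alpha>" and "\<alpha> < 2"
    and "D \<noteq> {}" and "bounded D" and "open D" and "C11_set D"
  shows "(\<forall>x\<in>D. 0 \<le> shooting_down_intensity \<alpha> D x - killing_intensity \<alpha> D x) \<and>
    (\<forall>\<epsilon>>0. \<exists>\<eta>>0. \<forall>x\<in>D. infdist x (- D) < \<eta> \<longrightarrow>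
      shooting_down_intensity \<alpha> D x - killing_intensity \<alpha> D x \<le> \<epsilon> * killing_intensity \<alpha> D x)"
proof (intro conjI ballI allI impI)
  note A = stable_const_nonneg[OF \<open>0 < \<alpha>\<close>, where 'a = 'a]
  fix x assume "x \<in> D"
  show "0 \<le> shooting_down_intensity \<alpha> D x - killing_intensity \<alpha> D x"
    unfolding shooting_down_minus_killing[OF \<open>0 < \<alpha>\<close> \<open>open D\<close> \<open>x \<in> D\<close>] set_lebesgue_integral_def
    by (rule integral_nonneg_AE) (simp add: levy_density_def A)
next
  let ?A = "stable_const TYPE('a) \<alpha>" and ?d = "DIM('a)"
  let ?V = "unit_ball_vol (real DIM('a))" and ?C = "powr_tail_const TYPE('a) \<alpha>"
  note A = stable_const_nonneg[OF \<open>0 < \<alpha>\<close>, where 'a = 'a]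
  fix \<epsilon> :: real assume "0 < \<epsilon>"
  obtain r where r: "0 < r" "C11_at_scale D r"
    using \<open>C11_set D\<close> by (auto simp: C11_set_def)
  \<comment> \<open>The complement is thus nonempty, so \<open>infdist x (- D)\<close> is a genuine
    distance and not the default \<open>0\<close> for the empty set.\<close>
  have "D \<noteq> UNIV"
    using \<open>bounded D\<close> by auto
  \<comment> \<open>The constant of the lower bound for the killing integral. The budget
    \<open>\<epsilon> * c\<close> is halved: first \<open>M\<close> is chosen for the far part, then
    \<open>N\<close>, depending on \<open>M\<close>, for the near part.\<close>
  define c where "c = ?V * 3 powr (- real ?d - \<alpha>)"
  have c: "0 < \<epsilon> * c / 2"
    using \<open>0 < \<epsilon>\<close> by (simp add: c_def)
  have "((\<lambda>M. ?C * M powr - \<alpha>) \<longlongrightarrow> ?C * 0) at_top"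
    using \<open>0 < \<alpha>\<close> by (intro tendsto_mult_left tendsto_neg_powr filterlim_ident) auto
  then have "\<forall>\<^sub>F M in at_top. ?C * M powr - \<alpha> < \<epsilon> * c / 2"
    using c by (intro order_tendstoD(2)) auto
  then have "\<forall>\<^sub>F M in at_top. 0 < M \<and> ?C * M powr - \<alpha> < \<epsilon> * c / 2"
    using eventually_gt_at_top[of "0::real"] by eventually_elim auto
  then obtain M where M: "0 < M" "?C * M powr - \<alpha> < \<epsilon> * c / 2"
    by (auto dest!: eventually_happens)
  have "((\<lambda>N. ?V * (2 * M) ^ ?d / real N) \<longlongrightarrow> 0) sequentially"
    by (rule lim_const_over_n)
  then have "\<forall>\<^sub>F N in sequentially. ?V * (2 * M) ^ ?d / real N < \<epsilon> * c / 2"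
    using c by (intro order_tendstoD(2)) auto
  then have "\<forall>\<^sub>F N in sequentially. 0 < N \<and> ?V * (2 * M) ^ ?d / real N < \<epsilon> * c / 2"
    using eventually_gt_at_top[of "0::nat"] by eventually_elim auto
  then obtain N where N: "0 < N" "?V * (2 * M) ^ ?d / real N < \<epsilon> * c / 2"
    by (auto dest!: eventually_happens)
  \<comment> \<open>The first entry keeps \<open>x\<close> inside the inner tangent ball; the second
    is the fitting condition for the slabs solved for \<delta>.\<close>
  define \<eta> where "\<eta> = min r (2 * r * M / (3 * real N * (M + 1)\<^sup>2))"
  show "\<exists>\<eta>>0. \<forall>x\<in>D. infdist x (- D) < \<eta> \<longrightarrow>
      shooting_down_intensity \<alpha> D x - killing_intensity \<alpha> D x \<le> \<epsilon> * killing_intensity \<alpha> D x"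
  proof (intro exI[of _ \<eta>] conjI ballI impI)
    show "0 < \<eta>"
      using r M N by (simp add: \<eta>_def)
    fix x assume x: "x \<in> D" "infdist x (- D) < \<eta>"
    define \<delta> where "\<delta> = infdist x (- D)"
    obtain Q n where Q: "norm n = 1" "x = Q + \<delta> *\<^sub>R n" "0 < \<delta>"
      "ball x \<delta> \<subseteq> D" "ball (Q + r *\<^sub>R n) r \<subseteq> D" "ball (Q - r *\<^sub>R n) r \<subseteq> - D"
      using C11_tangent_balls[OF \<open>open D\<close> \<open>D \<noteq> UNIV\<close> \<open>x \<in> D\<close> r(2,1)] unfolding \<delta>_def by metis
    have "\<delta> < \<eta>"
      using x by (simp add: \<delta>_def)
    then have \<delta>: "\<delta> \<le> r" "3 * real N * (M + 1)\<^sup>2 * \<delta> \<le> 2 * r * M"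
      using M N by (simp_all add: \<eta>_def field_simps)
    let ?k = "LINT y:- D|lborel. norm (y - x) powr (- real ?d - \<alpha>)"
    have "(LINT y:D - visible_part D x|lborel. norm (y - x) powr (- real ?d - \<alpha>))
        \<le> (?C * M powr - \<alpha> + ?V * (2 * M) ^ ?d / real N) * \<delta> powr - \<alpha>"
      by (rule nonvisible_integral_le[OF \<open>0 < \<alpha>\<close> \<open>open D\<close> Q(1-3) \<delta>(1) Q(4-6) M(1) N(1) \<delta>(2)])
    also have "\<dots> \<le> \<epsilon> * c * \<delta> powr - \<alpha>"
    proof (rule mult_right_mono)
      show "?C * M powr - \<alpha> + ?V * (2 * M) ^ ?d / real N \<le> \<epsilon> * c"
        using M(2) N(2) by linarith
    qed simp
    also have "\<dots> = \<epsilon> * (c * \<delta> powr - \<alpha>)"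
      by simp
    also have "\<dots> \<le> \<epsilon> * ?k"
      unfolding c_def using \<open>0 < \<epsilon>\<close>
      by (intro mult_left_mono killing_integral_ge[OF \<open>0 < \<alpha>\<close> \<open>open D\<close> Q(1-3) \<delta>(1) Q(4,6)]) simp
    finally have "?A * (LINT y:D - visible_part D x|lborel. norm (y - x) powr (- real ?d - \<alpha>))
        \<le> ?A * (\<epsilon> * ?k)"
      using A by (rule mult_left_mono)
    then show "shooting_down_intensity \<alpha> D x - killing_intensity \<alpha> D x \<le> \<epsilon> * killing_intensity \<alpha> D x"
      unfolding shooting_down_minus_killing[OF \<open>0 < \<alpha>\<close> \<open>open D\<close> \<open>x \<in> D\<close>]
      by (simp add: killing_intensity_def levy_density_def mult_ac)
  qed
qed

end
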